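(* There exist a selectively star-ccc topological space $X$ and a compact topological space $Y$ such that the product space $X\times Y$ is not selectively star-ccc.
   Context: For an open cover $\mathcal{U}$ of a space $X$ and $A\subset X$, put $\operatorname{st}(A,\mathcal{U})=\bigcup\{U\in\mathcal{U}:U\cap A\neq\emptyset\}$. $X$ is selectively star-ccc if for every open cover $\mathcal{U}$ of $X$ and every sequence $(\mathcal{A}_n:n\in\omega)$ of maximal pairwise disjoint families of open subsets of $X$, there is a sequence $(A_n:n\in\omega)$ with $A_n\in\mathcal{A}_n$ for all $n$ such that $\operatorname{st}(\bigcup_{n\in\omega}A_n,\mathcal{U})=X$. The members of a maximal pairwise disjoint family of open sets are taken to be nonempty, and the spaces $X$, $Y$ are understood to be nonempty. *)

theory Defs
  imports "HOL-Analysis.Analysis"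
begin

definition open_cover :: "'a topology \<Rightarrow> 'a set set \<Rightarrow> bool" where
  "open_cover X \<U> \<longleftrightarrow> (\<forall>U\<in>\<U>. openin X U) \<and> \<Union>\<U> = topspace X"

definition star :: "'a set \<Rightarrow> 'a set set \<Rightarrow> 'a set" where
  "star A \<U> = \<Union>{U \<in> \<U>. U \<inter> A \<noteq> {}}"

(* Members are required to be nonempty; otherwise the empty set could be added to
   any such family, and every maximal family would contain it. *)
definition disjoint_open_family :: "'a topology \<Rightarrow> 'a set set \<Rightarrow> bool" where
  "disjoint_open_family X \<A> \<longleftrightarrow>
     (\<forall>A\<in>\<A>. openin X A \<and> A \<noteq> {}) \<and> pairwise disjnt \<A>"

definition maximal_disjoint_open_family :: "'a topology \<Rightarrow> 'a set set \<Rightarrow> bool" where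
  "maximal_disjoint_open_family X \<A> \<longleftrightarrow>
     disjoint_open_family X \<A> \<and>
     (\<forall>\<B>. disjoint_open_family X \<B> \<and> \<A> \<subseteq> \<B> \<longrightarrow> \<B> = \<A>)"

definition selectively_star_ccc :: "'a topology \<Rightarrow> bool" where
  "selectively_star_ccc X \<longleftrightarrow>
     (\<forall>\<U> (\<A> :: nat \<Rightarrow> 'a set set).
        open_cover X \<U> \<and> (\<forall>n. maximal_disjoint_open_family X (\<A> n)) \<longrightarrow>
        (\<exists>A :: nat \<Rightarrow> 'a set.
           (\<forall>n. A n \<in> \<A> n) \<and> star (\<Union>n. A n) \<U> = topspace X))"

end

(* X is an uncountable space with the particular point topology: all nonempty open sets
   share the point 0, so any single nonempty open set has star X. Y is the one-point
   compactification of an uncountable discrete set D, realised on the same points with 0 at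
   infinity. In X \<times> Y the slices X \<times> {d}, d \<in> D, form a maximal disjoint family. The
   points (d, d) can be separated from all slices but their own: cover X \<times> Y by these slices
   and by the boxes {0, x} \<times> (Y - {x}). A countable choice of slices then misses the
   point (d, d) for every d that was not chosen. *)
theory Submission
  imports Defs
begin

definition particular_point_topology :: "'a \<Rightarrow> 'a topology" where
  "particular_point_topology p = topology (\<lambda>U. U = {} \<or> p \<in> U)"

lemma openin_particular_point_topology:
  "openin (particular_point_topology p) U \<longleftrightarrow> U = {} \<or> p \<in> U"
proof -
  have "istopology (\<lambda>U. U = {} \<or> p \<in> U)"
    unfolding istopology_def by blast
  then show ?thesis
    by (simp add: particular_point_topology_def topology_inverse')
qed

lemma topspace_particular_point_topology [simp]:
  "topspace (particular_point_topology p) = UNIV"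
  using openin_subset[of "particular_point_topology p" UNIV]
  by (auto simp: openin_particular_point_topology)

text \<open>The Fort space: points other than \<open>p\<close> are isolated, and the neighbourhoods
  of \<open>p\<close> are the cofinite sets containing it.\<close>

definition fort_topology :: "'a \<Rightarrow> 'a topology" where
  "fort_topology p = topology (\<lambda>U. p \<in> U \<longrightarrow> finite (- U))"

lemma openin_fort_topology:
  "openin (fort_topology p) U \<longleftrightarrow> (p \<in> U \<longrightarrow> finite (- U))"
proof -
  have "istopology (\<lambda>U. p \<in> U \<longrightarrow> finite (- U))"
    unfolding istopology_def
  proof (intro conjI allI impI)
    fix \<K> :: "'a set set"
    assume K: "\<forall>K\<in>\<K>. p \<in> K \<longrightarrow> finite (- K)" and "p \<in> \<Union>\<K>"
    then obtain K where "K \<in> \<K>" "finite (- K)" by blast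
    then show "finite (- \<Union>\<K>)"
      by (meson Compl_anti_mono Union_upper finite_subset)
  qed auto
  then show ?thesis
    by (simp add: fort_topology_def topology_inverse')
qed

lemma topspace_fort_topology [simp]: "topspace (fort_topology p) = UNIV"
  using openin_subset[of "fort_topology p" UNIV] by (auto simp: openin_fort_topology)

text \<open>A cover member containing \<open>p\<close> misses only finitely many points, and one
  further member for each of them completes a finite subcover.\<close>

lemma compact_space_fort_topology: "compact_space (fort_topology p)"
  unfolding compact_space_alt
proof (intro allI impI, elim conjE)
  fix \<U> assume op: "\<forall>U\<in>\<U>. openin (fort_topology p) U"
    and cov: "topspace (fort_topology p) \<subseteq> \<Union>\<U>"
  from cov have "\<forall>y. \<exists>U. U \<in> \<U> \<and> y \<in> U" by auto
  then obtain f where f: "\<And>y. f y \<in> \<U> \<and> y \<in> f y" by metis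
  then have "finite (- f p)"
    using op by (simp add: openin_fort_topology)
  moreover have "UNIV \<subseteq> \<Union>(insert (f p) (f ` (- f p)))"
    using f by auto
  ultimately show "\<exists>\<F>. finite \<F> \<and> \<F> \<subseteq> \<U> \<and> topspace (fort_topology p) \<subseteq> \<Union>\<F>"
    using f by (intro exI[of _ "insert (f p) (f ` (- f p))"]) auto
qed

text \<open>A member of a larger disjoint family meets some member of \<open>\<A>\<close>, so
  disjointness forces the two to coincide.\<close>

lemma maximal_disjoint_open_familyI:
  assumes "disjoint_open_family X \<A>"
    and meets: "\<And>W. openin X W \<Longrightarrow> W \<noteq> {} \<Longrightarrow> \<exists>A\<in>\<A>. A \<inter> W \<noteq> {}"
  shows "maximal_disjoint_open_family X \<A>"
  unfolding maximal_disjoint_open_family_def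
proof (intro conjI allI impI assms(1))
  fix \<B> assume B: "disjoint_open_family X \<B> \<and> \<A> \<subseteq> \<B>"
  have "W \<in> \<A>" if "W \<in> \<B>" for W
  proof -
    have "openin X W" "W \<noteq> {}"
      using B \<open>W \<in> \<B>\<close> unfolding disjoint_open_family_def by simp_all
    then obtain A where A: "A \<in> \<A>" "A \<inter> W \<noteq> {}"
      using meets by metis
    then have "A = W"
      using B \<open>W \<in> \<B>\<close> unfolding disjoint_open_family_def by (meson disjnt_def pairwiseD subsetD)
    with A show ?thesis by simp
  qed
  with B show "\<B> = \<A>" by blast
qed

text \<open>Otherwise the whole space could be added. This is what permits choosing a member of each
  family.\<close>

lemma maximal_disjoint_open_family_nonempty:
  assumes "maximal_disjoint_open_family X \<A>" "topspace X \<noteq> {}"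
  shows "\<A> \<noteq> {}"
proof
  assume "\<A> = {}"
  moreover have "disjoint_open_family X {topspace X}"
    using assms(2) by (simp add: disjoint_open_family_def)
  ultimately show False
    using assms(1) unfolding maximal_disjoint_open_family_def by blast
qed

text \<open>Any choice of members works: the chosen sets and all nonempty members of the cover
  contain \<open>p\<close>.\<close>

lemma selectively_star_ccc_particular_point_topology:
  "selectively_star_ccc (particular_point_topology p)"
  unfolding selectively_star_ccc_def
proof (intro allI impI, elim conjE)
  fix \<U> and \<A> :: "nat \<Rightarrow> 'a set set"
  let ?X = "particular_point_topology p"
  assume \<U>: "open_cover ?X \<U>" and \<A>: "\<forall>n. maximal_disjoint_open_family ?X (\<A> n)"
  have "\<exists>A. A \<in> \<A> n" for n
    using maximal_disjoint_open_family_nonempty[OF \<A>[rule_format, of n]] by auto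
  then obtain A where A: "\<And>n. A n \<in> \<A> n" by metis
  have "p \<in> A n" for n
    using A[of n] \<A> unfolding maximal_disjoint_open_family_def disjoint_open_family_def
    by (metis openin_particular_point_topology)
  then have p: "p \<in> (\<Union>n. A n)" by blast
  have pU: "p \<in> U" if "U \<in> \<U>" "x \<in> U" for U x
    using that \<U> unfolding open_cover_def by (metis openin_particular_point_topology empty_iff)
  have "star (\<Union>n. A n) \<U> = \<Union>\<U>"
  proof
    show "\<Union>\<U> \<subseteq> star (\<Union>n. A n) \<U>"
    proof
      fix x assume "x \<in> \<Union>\<U>"
      then obtain U where U: "U \<in> \<U>" "x \<in> U" by blast
      then have "U \<inter> (\<Union>n. A n) \<noteq> {}"
        using p pU[OF U] by blast
      with U show "x \<in> star (\<Union>n. A n) \<U>"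
        unfolding star_def by blast
    qed
  qed (auto simp: star_def)
  then show "\<exists>A. (\<forall>n. A n \<in> \<A> n) \<and> star (\<Union>n. A n) \<U> = topspace ?X"
    using A \<U> unfolding open_cover_def by metis
qed

text \<open>Uncountability enters twice: infinitely many points keep \<open>{p}\<close> from being
  open in the Fort space, so the slices are maximal, and no countable choice exhausts the
  slices.\<close>

lemma not_selectively_star_ccc_particular_point_times_fort:
  fixes p :: 'a
  assumes unc: "uncountable (UNIV :: 'a set)"
  shows "\<not> selectively_star_ccc (prod_topology (particular_point_topology p) (fort_topology p))"
    (is "\<not> selectively_star_ccc ?Z")
proof
  assume ccc: "selectively_star_ccc ?Z"
  define slices where "slices = (\<lambda>d. UNIV \<times> {d} :: ('a \<times> 'a) set) ` (- {p})"
  \<comment> \<open>\<open>{p, x}\<close> is the least open set around \<open>x\<close>, and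
    \<open>- {x}\<close> is a neighbourhood of \<open>p\<close>; their product omits
    \<open>(x, x)\<close>.\<close>
  define boxes where "boxes = (\<lambda>x. {p, x} \<times> (- {x}) :: ('a \<times> 'a) set) ` (- {p})"
  have top: "topspace ?Z = UNIV" by simp
  have inf: "infinite (UNIV :: 'a set)"
    using unc countable_finite by blast
  have open_slices: "\<forall>S\<in>slices. openin ?Z S"
    by (auto simp: slices_def openin_prod_Times_iff openin_particular_point_topology
        openin_fort_topology)
  have open_boxes: "\<forall>B\<in>boxes. openin ?Z B"
    by (auto simp: boxes_def openin_prod_Times_iff openin_particular_point_topology
        openin_fort_topology)
  obtain q where q: "q \<noteq> p"
    using ex_new_if_finite[OF inf, of "{p}"] by auto
  have "z \<in> \<Union>(slices \<union> boxes)" for z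
  proof (cases "snd z = p")
    case True
    \<comment> \<open>Boxes are indexed by points other than \<open>p\<close>, so the point
      \<open>(p, p)\<close> is covered by the box of \<open>q\<close>.\<close>
    define x where "x = (if fst z = p then q else fst z)"
    have "x \<in> - {p}" "z \<in> {p, x} \<times> - {x}"
      using True q by (auto simp: x_def mem_Times_iff)
    moreover from this(1) have "{p, x} \<times> - {x} \<in> boxes"
      unfolding boxes_def by (rule imageI)
    ultimately show ?thesis
      by (intro UnionI[of "{p, x} \<times> - {x}"] UnI2)
  qed (auto simp: slices_def mem_Times_iff)
  then have "open_cover ?Z (slices \<union> boxes)"
    unfolding open_cover_def top using open_slices open_boxes by blast
  moreover have "maximal_disjoint_open_family ?Z slices"
  proof (rule maximal_disjoint_open_familyI)
    show "disjoint_open_family ?Z slices"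
      using open_slices unfolding disjoint_open_family_def pairwise_def disjnt_def
      by (auto simp: slices_def)
  next
    fix W assume W: "openin ?Z W" "W \<noteq> {}"
    then obtain x y where "(x, y) \<in> W" by auto
    then obtain P Q where Q: "openin (fort_topology p) Q" "y \<in> Q"
      and W: "x \<in> P" "P \<times> Q \<subseteq> W"
      using W(1)[unfolded openin_prod_topology_alt, rule_format, of x y] by metis
    \<comment> \<open>Such a \<open>d\<close> gives a slice meeting \<open>W\<close> in
      \<open>(x, d)\<close>.\<close>
    have "\<exists>d\<in>Q. d \<noteq> p"
    proof (rule ccontr)
      assume "\<not> (\<exists>d\<in>Q. d \<noteq> p)"
      then have "Q \<subseteq> {p}" by blast
      then have "Q = {p}" using Q(2) by (simp add: subset_singleton_iff) blast
      then show False
        using Q inf by (simp add: openin_fort_topology)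
    qed
    then show "\<exists>A\<in>slices. A \<inter> W \<noteq> {}"
      using W by (auto simp: slices_def)
  qed
  ultimately have "\<exists>A. (\<forall>n::nat. A n \<in> slices) \<and> star (\<Union>n. A n) (slices \<union> boxes) = UNIV"
    using ccc[unfolded selectively_star_ccc_def, rule_format, of "slices \<union> boxes" "\<lambda>_. slices"]
    unfolding top by simp
  then obtain A where A: "\<And>n::nat. A n \<in> slices"
    and star: "star (\<Union>n. A n) (slices \<union> boxes) = UNIV"
    by metis
  have "\<exists>d. A n = UNIV \<times> {d}" for n
    using A[of n] by (auto simp: slices_def)
  then obtain d where d: "\<And>n. A n = UNIV \<times> {d n}"
    by metis
  \<comment> \<open>Including \<open>p\<close> ensures \<open>e \<noteq> p\<close>; the point
    \<open>(p, p)\<close> lies in every box.\<close>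
  have "countable (insert p (range d))" by simp
  then have "insert p (range d) \<noteq> UNIV"
    using unc by metis
  then obtain e where e: "e \<noteq> p" "e \<notin> range d" by blast
  have "(e, e) \<in> star (\<Union>n. A n) (slices \<union> boxes)"
    unfolding star by simp
  then obtain U where U: "U \<in> slices \<union> boxes" "(e, e) \<in> U" "U \<inter> (\<Union>n. A n) \<noteq> {}"
    unfolding star_def by blast
  \<comment> \<open>A box containing \<open>(e, e)\<close> would need \<open>e = x\<close> in the
    first factor and \<open>e \<noteq> x\<close> in the second.\<close>
  then have "U = UNIV \<times> {e}"
    using e by (auto simp: slices_def boxes_def)
  then show False
    using U(3) e(2) d by auto
qed

theorem mainTheorem4:
  "\<exists>(X :: real topology) (Y :: real topology).
     topspace X \<noteq> {} \<and> topspace Y \<noteq> {} \<and>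
     selectively_star_ccc X \<and> compact_space Y \<and>
     \<not> selectively_star_ccc (prod_topology X Y)"
  \<comment> \<open>\<open>real\<close> supplies an uncountable set of points for both spaces, with
    0 as the distinguished point.\<close>
  using selectively_star_ccc_particular_point_topology[of "0 :: real"]
    compact_space_fort_topology[of "0 :: real"]
    not_selectively_star_ccc_particular_point_times_fort[OF uncountable_UNIV_real, of 0]
  by (intro exI[of _ "particular_point_topology 0"] exI[of _ "fort_topology 0"]) simp

end
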